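(* Let $\mathcal{A}$ be a unital Banach algebra, let $n\geq 1$ be an integer, and let $a_0,a_1,\dots,a_n\in\mathcal{A}$ with $a_0$ and $a_n$ invertible. Let $p(z)=a_0+a_1z+\cdots+a_{n-1}z^{n-1}+a_nz^n\in\mathcal{A}[z]$. Let $u\in\mathcal{A}$ be such that $p(u)=0$, $u$ is invertible, and $\|(u^{-1})^n\|=\|u^{-1}\|^n$. Then $$\frac{1}{\|u^{-1}\|}>\frac{1}{1+\max_{1\leq j\leq n}\|a_0^{-1}a_j\|}\geq\frac{1}{1+\|a_0^{-1}\|\max_{1\leq j\leq n}\|a_j\|}.$$
   Context: Here $\mathcal{A}$ is a (possibly noncommutative) Banach algebra with unit $1\neq 0$, and $\mathcal{A}[z]$ is the set of polynomials over $\mathcal{A}$. Coefficients are written on the left of the powers of $z$, and $p(u)$ means $p(u)=a_0+a_1u+\cdots+a_nu^n$. *)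

theory Defs
  imports "HOL-Analysis.Analysis" "HOL-Computational_Algebra.Polynomial"
begin

text \<open>
  The library's \<open>inverse\<close> and \<open>is_unit\<close> are tied to division rings and commutative rings,
  so two-sided inverses in a general unital ring are introduced here.
\<close>

definition two_sided_inverse :: "'a::monoid_mult \<Rightarrow> 'a \<Rightarrow> bool"
  where "two_sided_inverse x y \<longleftrightarrow> x * y = 1 \<and> y * x = 1"

definition invertible_elem :: "'a::monoid_mult \<Rightarrow> bool"
  where "invertible_elem x \<longleftrightarrow> (\<exists>y. two_sided_inverse x y)"

text \<open>Unspecified if \<open>x\<close> is not invertible.\<close>

definition inverse_elem :: "'a::monoid_mult \<Rightarrow> 'a"
  where "inverse_elem x = (THE y. two_sided_inverse x y)"

lemma two_sided_inverse_unique: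
  assumes "two_sided_inverse x y" and "two_sided_inverse x z"
  shows "y = z"
  using assms unfolding two_sided_inverse_def by (metis mult.assoc mult_1_left mult_1_right)

lemma inverse_elem:
  assumes "invertible_elem x"
  shows "x * inverse_elem x = 1" and "inverse_elem x * x = 1"
proof -
  have "two_sided_inverse x (inverse_elem x)"
    unfolding inverse_elem_def using assms
    by (auto simp: invertible_elem_def intro: theI two_sided_inverse_unique)
  then show "x * inverse_elem x = 1" and "inverse_elem x * x = 1"
    by (simp_all add: two_sided_inverse_def)
qed

text \<open>
  Evaluation with coefficients to the left of the powers of the argument. The library's
  \<open>poly\<close> requires a commutative coefficient ring.
\<close>

definition left_eval :: "'a::ring_1 poly \<Rightarrow> 'a \<Rightarrow> 'a"
  where "left_eval p u = (\<Sum>j\<le>degree p. coeff p j * u ^ j)"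

end

theory Submission
  imports Defs
begin

text \<open>
  Let \<open>v = u\<^sup>-\<^sup>1\<close> and \<open>b\<^sub>j = a\<^sub>0\<^sup>-\<^sup>1 a\<^sub>j\<close>. Multiplying \<open>p(u) = 0\<close> by \<open>a\<^sub>0\<^sup>-\<^sup>1\<close> on the left and
  by \<open>v\<^sup>n\<close> on the right turns it into a monic equation for \<open>v\<close>, namely
  \<open>v\<^sup>n = - (b\<^sub>1 v\<^sup>n\<^sup>-\<^sup>1 + \<dots> + b\<^sub>n)\<close> (lemma \<open>reversed_root_equation\<close>). Write \<open>t\<close> for the norm of \<open>v\<close>
  and \<open>M\<close> for the largest norm of a \<open>b\<^sub>j\<close>. Since the norm of \<open>v\<^sup>n\<close> is exactly \<open>t\<^sup>n\<close>, taking
  norms gives \<open>t\<^sup>n \<le> M (1 + t + \<dots> + t\<^sup>n\<^sup>-\<^sup>1)\<close>, and Cauchy's classical argument with the geometric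
  sum yields \<open>t < 1 + M\<close> (lemma \<open>Cauchy_root_bound\<close>). This is the first inequality after taking
  reciprocals; the second is submultiplicativity of the norm.

  The norm is only submultiplicative, so the unit may have norm greater than \<open>1\<close>, and
  the bound of the norm of \<open>v\<^sup>k\<close> by \<open>t\<^sup>k\<close> can fail for \<open>k = 0\<close>. The one term of the monic equation
  with exponent \<open>0\<close> is \<open>b\<^sub>n\<close> itself, which is bounded directly.
\<close>

lemma left_eval_eq_sum:
  assumes "degree p \<le> n"
  shows "left_eval p u = (\<Sum>j\<le>n. coeff p j * u ^ j)"
  unfolding left_eval_def
  by (rule sum.mono_neutral_left) (use assms in \<open>auto simp: coeff_eq_0\<close>)

lemma left_eval_sum_monom:
  "left_eval (\<Sum>j\<le>n. monom (a j) j) u = (\<Sum>j\<le>n. a j * u ^ j)"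
proof -
  have "degree (\<Sum>j\<le>n. monom (a j) j) \<le> n"
    by (rule degree_sum_le) (auto intro: order_trans[OF degree_monom_le])
  moreover have "coeff (\<Sum>j\<le>n. monom (a j) j) k = a k" if "k \<le> n" for k
    using that by (simp add: coeff_sum sum.delta)
  ultimately show ?thesis
    by (simp add: left_eval_eq_sum)
qed

lemma inverse_elem_neq_0:
  fixes x :: "'a::ring_1"
  assumes "invertible_elem x"
  shows "inverse_elem x \<noteq> 0"
  using inverse_elem(1)[OF assms] by auto

lemma right_inverse_power_diff:
  fixes u v :: "'a::monoid_mult"
  assumes "u * v = 1" and "j \<le> n"
  shows "u ^ j * v ^ n = v ^ (n - j)"
  using assms(2)
proof (induction j arbitrary: n)
  case (Suc j)
  then obtain m where m: "n = Suc m" "j \<le> m"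
    by (cases n) auto
  have "u ^ Suc j * v ^ n = u ^ j * (u * v) * v ^ m"
    by (simp only: m(1) power_Suc2[of u] power_Suc[of v] mult.assoc)
  also have "\<dots> = v ^ (n - Suc j)"
    using Suc.IH[OF m(2)] m by (simp add: assms(1))
  finally show ?case .
qed simp

lemma reversed_root_equation:
  fixes u v :: "'a::ring_1"
  assumes root: "(\<Sum>j\<le>n. a j * u ^ j) = 0"
    and c: "c * a 0 = 1" and v: "u * v = 1"
  shows "v ^ n = - (\<Sum>j=1..n. (c * a j) * v ^ (n - j))"
proof -
  have "0 = c * (\<Sum>j\<le>n. a j * u ^ j) * v ^ n"
    by (simp add: root)
  also have "\<dots> = (\<Sum>j\<le>n. (c * a j) * (u ^ j * v ^ n))"
    by (simp add: sum_distrib_left sum_distrib_right mult.assoc)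
  also have "\<dots> = (\<Sum>j\<le>n. (c * a j) * v ^ (n - j))"
    by (intro sum.cong) (auto simp: right_inverse_power_diff[OF v])
  also have "\<dots> = v ^ n + (\<Sum>j=1..n. (c * a j) * v ^ (n - j))"
    by (simp add: atMost_atLeast0 sum.atLeast_Suc_atMost c)
  finally show ?thesis
    by (simp add: eq_neg_iff_add_eq_0)
qed

lemma norm_power_Suc_le:
  fixes x :: "'a::{real_normed_algebra, ring_1}"
  shows "norm (x ^ Suc k) \<le> norm x ^ Suc k"
proof (induction k)
  case (Suc k)
  have "norm (x ^ Suc (Suc k)) \<le> norm x * norm (x ^ Suc k)"
    by (simp only: power_Suc[of x "Suc k"] norm_mult_ineq)
  also have "\<dots> \<le> norm x * norm x ^ Suc k"
    by (intro mult_left_mono Suc.IH) simp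
  finally show ?case
    by simp
qed simp

text \<open>
  A factor \<open>b\<close> absorbs the zeroth power of \<open>x\<close>, so the bound holds also for \<open>k = 0\<close>,
  where the norm of \<open>x ^ k = 1\<close> may exceed \<open>1\<close>.
\<close>

lemma norm_mult_power_le:
  fixes b x :: "'a::{real_normed_algebra, ring_1}"
  shows "norm (b * x ^ k) \<le> norm b * norm x ^ k"
proof (cases k)
  case (Suc m)
  have "norm (b * x ^ k) \<le> norm b * norm (x ^ k)"
    by (rule norm_mult_ineq)
  also have "\<dots> \<le> norm b * norm x ^ k"
    unfolding Suc by (intro mult_left_mono norm_power_Suc_le) simp
  finally show ?thesis .
qed simp

text \<open>
  For \<open>t > 1\<close> the hypothesis reads \<open>(t - 1) t\<^sup>n \<le> M (t\<^sup>n - 1) < M t\<^sup>n\<close>. Strictness comes from the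
  \<open>- 1\<close> left over in the geometric sum and, for \<open>t \<le> 1\<close>, from \<open>M > 0\<close>.
\<close>

lemma Cauchy_root_bound:
  fixes t M :: real
  assumes "M > 0" and le: "t ^ n \<le> M * (\<Sum>k<n. t ^ k)"
  shows "t < 1 + M"
proof (cases "t \<le> 1")
  case False
  have "(t - 1) * t ^ n \<le> (t - 1) * (M * (\<Sum>k<n. t ^ k))"
    using le False by (intro mult_left_mono) auto
  also have "\<dots> = M * (t ^ n - 1)"
    by (simp add: power_diff_1_eq mult.left_commute)
  also have "\<dots> < M * t ^ n"
    using \<open>M > 0\<close> by simp
  finally have "t - 1 < M"
    by (rule mult_right_less_imp_less) (use False in simp)
  then show ?thesis
    by simp
qed (use \<open>M > 0\<close> in linarith)

theorem theorem2p3: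
  fixes a :: "nat \<Rightarrow> 'a::{real_normed_algebra, ring_1, banach}"
    and p :: "'a poly"
    and u :: 'a
    and n :: nat
  assumes "n \<ge> 1"
    and "invertible_elem (a 0)"
    and "invertible_elem (a n)"
    and "p = (\<Sum>j\<le>n. monom (a j) j)"
    and "left_eval p u = 0"
    and "invertible_elem u"
    and "norm (inverse_elem u ^ n) = norm (inverse_elem u) ^ n"
  shows "1 / norm (inverse_elem u) > 1 / (1 + (MAX j\<in>{1..n}. norm (inverse_elem (a 0) * a j)))
    \<and> 1 / (1 + (MAX j\<in>{1..n}. norm (inverse_elem (a 0) * a j)))
      \<ge> 1 / (1 + norm (inverse_elem (a 0)) * (MAX j\<in>{1..n}. norm (a j)))"
proof -
  define c where "c = inverse_elem (a 0)"
  define v where "v = inverse_elem u"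
  define t where "t = norm v"
  define M where "M = (MAX j\<in>{1..n}. norm (c * a j))"
  define N where "N = (MAX j\<in>{1..n}. norm (a j))"

  have le_M: "norm (c * a j) \<le> M" if "j \<in> {1..n}" for j
    unfolding M_def using that by (intro Max_ge) auto
  have le_N: "norm (a j) \<le> N" if "j \<in> {1..n}" for j
    unfolding N_def using that by (intro Max_ge) auto
  have "t > 0"
    using inverse_elem_neq_0[OF assms(6)] by (simp add: t_def v_def)

  \<comment> \<open>In a ring with zero divisors, \<open>c * a n \<noteq> 0\<close> needs \<open>c\<close> to be cancellable, not just nonzero.\<close>
  have "a 0 * (c * a n) * inverse_elem (a n) = 1"
    using inverse_elem(1)[OF assms(2)] inverse_elem(1)[OF assms(3)]
    by (simp add: c_def mult.assoc[symmetric])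
  then have "c * a n \<noteq> 0"
    by auto
  then have "M > 0"
    using le_M[of n] assms(1) by (simp add: less_le_trans[of 0 "norm (c * a n)"])

  have "v ^ n = - (\<Sum>j=1..n. (c * a j) * v ^ (n - j))"
  proof (rule reversed_root_equation)
    show "(\<Sum>j\<le>n. a j * u ^ j) = 0"
      using assms(5) unfolding assms(4) left_eval_sum_monom .
  qed (simp_all add: c_def v_def inverse_elem assms)
  then have "t ^ n = norm (\<Sum>j=1..n. (c * a j) * v ^ (n - j))"
    using assms(7) by (simp add: t_def v_def)
  also have "\<dots> \<le> (\<Sum>j=1..n. M * t ^ (n - j))"
  proof (rule sum_norm_le)
    fix j assume "j \<in> {1..n}"
    then have "norm (c * a j) * t ^ (n - j) \<le> M * t ^ (n - j)"
      using \<open>t > 0\<close> by (intro mult_right_mono le_M) auto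
    then show "norm ((c * a j) * v ^ (n - j)) \<le> M * t ^ (n - j)"
      using norm_mult_power_le[of "c * a j" v "n - j"] by (simp add: t_def)
  qed
  also have "\<dots> = M * (\<Sum>k<n. t ^ k)"
    unfolding sum_distrib_left
    by (rule sum.reindex_bij_witness[where i = "\<lambda>k. n - k" and j = "\<lambda>j. n - j"]) auto
  finally have "t < 1 + M"
    by (rule Cauchy_root_bound[OF \<open>M > 0\<close>])
  then have first: "1 / (1 + M) < 1 / t"
    using \<open>t > 0\<close> by (intro divide_strict_left_mono) auto

  have "M \<le> norm c * N"
    unfolding M_def
  proof (rule Max.boundedI)
    fix x assume "x \<in> (\<lambda>j. norm (c * a j)) ` {1..n}"
    then obtain j where j: "j \<in> {1..n}" and x: "x = norm (c * a j)"
      by auto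
    have "x \<le> norm c * norm (a j)"
      unfolding x by (rule norm_mult_ineq)
    also have "\<dots> \<le> norm c * N"
      using le_N[OF j] by (intro mult_left_mono) auto
    finally show "x \<le> norm c * N" .
  qed (use assms(1) in auto)
  then have "1 / (1 + norm c * N) \<le> 1 / (1 + M)"
    using \<open>M > 0\<close> by (intro divide_left_mono) auto
  with first show ?thesis
    unfolding t_def v_def M_def N_def c_def by blast
qed

end
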